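(* Let $p>1$, let $I\subseteq\mathbb{R}$ be an interval, let $f:I\to[0,\infty)$ be a Young-convex function (with parameter $p$), and let $a,b\in I$ with $a<b$. Then $$2^{\frac1p}\frac{p}{p+1}f\left(\frac{a+b}{2}\right)\le\frac{1}{b-a}\int_a^b f(x)\,dx\le\left(\frac{p(p+2)}{(p+1)(1+2p)}+\frac{p-1}{p}\beta\left(\frac{1+p}{p},2\right)+\frac1p\beta\left(\frac1p,2\right)\right)\frac{f(a)+f(b)}{2},$$ where $\beta$ is the Euler beta function.
   Context: Definition (Young-convex function). Let $p>1$ and let $I\subseteq\mathbb{R}$ be a nonempty interval. A function $f:I\to[0,\infty)$ is called Young-convex (with parameter $p$) if $$f(tx+(1-t)y)\le\left(\frac1p t^{\frac1p}+\frac{p-1}{p}t^{1+\frac1p}\right)f(x)+\left(\frac{p-1}{p}(1-t)t^{\frac1p}+\frac1p t^{\frac1p-1}(1-t)\right)f(y)$$ for all $x,y\in I$ and all $t\in(0,1]$. The Euler beta function is $\beta(u,v)=\int_0^1 t^{u-1}(1-t)^{v-1}\,dt$ for $u,v>0$. *)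

theory Defs
  imports "HOL-Analysis.Analysis"
begin

(* The parameter is meant to satisfy p > 1 and I to be a nonempty interval; both are
   hypotheses wherever the notion is used. The codomain [0,oo) is part of the definition,
   and values of f outside I are irrelevant. *)
definition young_convex_on :: "real \<Rightarrow> real set \<Rightarrow> (real \<Rightarrow> real) \<Rightarrow> bool" where
  "young_convex_on p I f \<longleftrightarrow>
     (\<forall>x\<in>I. 0 \<le> f x) \<and>
     (\<forall>x\<in>I. \<forall>y\<in>I. \<forall>t\<in>{0<..1}.
        f (t * x + (1 - t) * y)
          \<le> (1 / p * t powr (1 / p) + (p - 1) / p * t powr (1 + 1 / p)) * f x
            + ((p - 1) / p * (1 - t) * t powr (1 / p)
               + 1 / p * t powr (1 / p - 1) * (1 - t)) * f y)"

(* The library defines Beta through Gamma; has_integral_Beta_real gives the Euler integral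
   for positive arguments. *)
lemma Beta_eq_Euler_integral:
  fixes u v :: real
  assumes "u > 0" "v > 0"
  shows "Beta u v = integral {0..1} (\<lambda>t. t powr (u - 1) * (1 - t) powr (v - 1))"
  using has_integral_Beta_real[OF assms] by (simp add: integral_unique)

end

theory Submission
  imports Defs
begin

text \<open>Let \<open>A\<close>, \<open>B\<close> be the coefficients of \<open>f x\<close>, \<open>f y\<close> in the Young-convexity inequality.
  As \<open>A t \<rightarrow> 1\<close> and \<open>B t \<rightarrow> 0\<close> for \<open>t \<rightarrow> 1\<close>, the inequality bounds \<open>f z\<close> from above and below
  near an interior point \<open>x\<close>, so \<open>f\<close> is continuous in the interior; on the segment from \<open>b\<close>
  to \<open>a\<close> it is dominated by the integrable function \<open>A t * f a + B t * f b\<close>, hence integrable.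
  The upper estimate is the integral of this bound, averaged with the one for \<open>a\<close> and \<open>b\<close>
  swapped; the lower one is the integral of the case \<open>t = 1/2\<close>, where \<open>A\<close> and \<open>B\<close> agree.\<close>

definition young_coeff1 :: "real \<Rightarrow> real \<Rightarrow> real" where
  "young_coeff1 p t = 1 / p * t powr (1 / p) + (p - 1) / p * t powr (1 + 1 / p)"

definition young_coeff2 :: "real \<Rightarrow> real \<Rightarrow> real" where
  "young_coeff2 p t = (p - 1) / p * (1 - t) * t powr (1 / p) + 1 / p * t powr (1 / p - 1) * (1 - t)"

lemma young_convex_onD:
  assumes "young_convex_on p I f" "x \<in> I" "y \<in> I" "0 < t" "t \<le> 1"
  shows "f (t * x + (1 - t) * y) \<le> young_coeff1 p t * f x + young_coeff2 p t * f y"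
  using assms by (auto simp: young_convex_on_def young_coeff1_def young_coeff2_def)

lemma young_convex_on_nonneg: "young_convex_on p I f \<Longrightarrow> x \<in> I \<Longrightarrow> 0 \<le> f x"
  by (auto simp: young_convex_on_def)

lemma young_coeff1_pos: "p > 1 \<Longrightarrow> 0 < t \<Longrightarrow> 0 < young_coeff1 p t"
  unfolding young_coeff1_def by (intro add_pos_nonneg mult_pos_pos mult_nonneg_nonneg) auto

lemma young_coeff2_nonneg: "p > 1 \<Longrightarrow> t \<le> 1 \<Longrightarrow> 0 \<le> young_coeff2 p t"
  unfolding young_coeff2_def by (intro add_nonneg_nonneg mult_nonneg_nonneg) auto

lemma young_coeff_1 [simp]:
  assumes "p > 1"
  shows "young_coeff1 p 1 = 1" "young_coeff2 p 1 = 0"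
  using assms by (auto simp: young_coeff1_def young_coeff2_def field_simps)

text \<open>Each coefficient reduces to \<open>(1/2) powr (1 / p)\<close> times
  \<open>1 / p + (p - 1) / (2 * p)\<close>; in the second one the factor \<open>1 - t = 1/2\<close>
  cancels the 2 contributed by \<open>t powr (1 / p - 1)\<close>. The common value is half the
  reciprocal of the constant in the lower estimate.\<close>

lemma young_coeff_half:
  assumes "p > 1"
  shows "young_coeff1 p (1/2) = (p + 1) / (2 * p) / 2 powr (1 / p)"
    and "young_coeff2 p (1/2) = (p + 1) / (2 * p) / 2 powr (1 / p)"
proof -
  have "(1/2) powr (1 / p) = inverse (2 powr (1 / p))"
    by (simp add: powr_divide inverse_eq_divide)
  then show "young_coeff1 p (1/2) = (p + 1) / (2 * p) / 2 powr (1 / p)"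
    and "young_coeff2 p (1/2) = (p + 1) / (2 * p) / 2 powr (1 / p)"
    unfolding young_coeff1_def young_coeff2_def powr_add powr_diff
    using assms by (simp_all add: divide_simps) (simp_all add: algebra_simps)
qed

lemma isCont_young_coeff:
  assumes "p > 1" "0 < t"
  shows "isCont (young_coeff1 p) t" "isCont (young_coeff2 p) t"
  using assms unfolding young_coeff1_def[abs_def] young_coeff2_def[abs_def]
  by (auto intro!: continuous_intros)

lemma has_integral_young_coeff1:
  assumes "p > 1"
  shows "(young_coeff1 p has_integral p * (p + 2) / ((p + 1) * (1 + 2 * p))) {0..1}"
proof -
  have "1 / p > 0" using assms by simp
  then have "(young_coeff1 p has_integral
      1 / p * (1 powr (1 / p + 1) / (1 / p + 1)) +
      (p - 1) / p * (1 powr (1 + 1 / p + 1) / (1 + 1 / p + 1))) {0..1}"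
    unfolding young_coeff1_def[abs_def]
    by (intro has_integral_add has_integral_mult_right has_integral_powr_from_0) linarith+
  moreover have "1 / p * (1 powr (1 / p + 1) / (1 / p + 1)) +
      (p - 1) / p * (1 powr (1 + 1 / p + 1) / (1 + 1 / p + 1))
      = 1 / (p + 1) + (p - 1) / (1 + 2 * p)"
    using assms by (simp add: divide_simps) (simp add: algebra_simps)
  moreover have "\<dots> = p * (p + 2) / ((p + 1) * (1 + 2 * p))"
    using assms by (simp add: divide_simps) (simp add: algebra_simps)
  ultimately show ?thesis by simp
qed

text \<open>Reading \<open>1 - t\<close> as \<open>(1 - t) powr (2 - 1)\<close> turns both terms
  into Euler integrands. The second is singular at 0, yet integrable because
  \<open>1 / p - 1 > -1\<close>.\<close>

lemma has_integral_young_coeff2: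
  assumes "p > 1"
  shows "(young_coeff2 p has_integral
    (p - 1) / p * Beta ((1 + p) / p) 2 + 1 / p * Beta (1 / p) 2) {0..1}"
proof -
  have "((\<lambda>t. (p - 1) / p * (t powr ((1 + p) / p - 1) * (1 - t) powr (2 - 1)) +
        1 / p * (t powr (1 / p - 1) * (1 - t) powr (2 - 1))) has_integral
      (p - 1) / p * Beta ((1 + p) / p) 2 + 1 / p * Beta (1 / p) 2) {0..1}"
    using assms
    by (intro has_integral_add has_integral_mult_right has_integral_Beta_real) auto
  then show ?thesis
  proof (rule has_integral_eq[rotated])
    have "(1 + p) / p - 1 = 1 / p" using assms by (simp add: field_simps)
    then show "(p - 1) / p * (t powr ((1 + p) / p - 1) * (1 - t) powr (2 - 1)) +
        1 / p * (t powr (1 / p - 1) * (1 - t) powr (2 - 1)) = young_coeff2 p t"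
      if "t \<in> {0..1}" for t
      using that by (simp add: young_coeff2_def)
  qed
qed

lemma young_convex_on_isCont:
  assumes "p > 1" and f: "young_convex_on p {a..b} f" and x: "a < x" "x < b"
  shows "isCont f x"
proof -
  \<comment> \<open>The largest radius that keeps both \<open>x - d\<close> and \<open>x + d\<close>
    in the interval; these two points serve as anchors for the bounds.\<close>
  define d where "d = min (x - a) (b - x)"
  \<comment> \<open>Since \<open>f\<close> is nonnegative, the sum dominates its value at either
    anchor, which makes the bounds independent of the side on which \<open>z\<close> lies.\<close>
  define M where "M = f (x - d) + f (x + d)"
  \<comment> \<open>The weight of \<open>x\<close> when \<open>z\<close> is written as a convex
    combination of \<open>x\<close> and the anchor on the same side as \<open>z\<close>.\<close>
  define t where "t = (\<lambda>z. 1 - \<bar>z - x\<bar> / d)"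
  \<comment> \<open>The weight of \<open>z\<close> when \<open>x\<close> is written as a convex
    combination of \<open>z\<close> and the anchor on the opposite side; solving that inequality for
    \<open>f z\<close> gives the lower bound.\<close>
  define s where "s = (\<lambda>z. d / (d + \<bar>z - x\<bar>))"
  have d: "d > 0" "x - d \<in> {a..b}" "x + d \<in> {a..b}"
    using x by (auto simp: d_def)
  have M: "f (x - d) \<le> M" "f (x + d) \<le> M"
    using d young_convex_on_nonneg[OF f] by (auto simp: M_def)
  have near: "\<forall>\<^sub>F z in at x. \<bar>z - x\<bar> < d"
    using d by (auto simp: eventually_at dist_real_def)
  have t: "isCont t x" "t x = 1" and s: "isCont s x" "s x = 1"
    using d by (auto simp: t_def s_def intro!: continuous_intros)
  have upper: "f z \<le> young_coeff1 p (t z) * f x + young_coeff2 p (t z) * M" if "\<bar>z - x\<bar> < d" for z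
  proof -
    define y where "y = (if z \<le> x then x - d else x + d)"
    have t01: "0 < t z" "t z \<le> 1" using that d by (auto simp: t_def)
    have z: "z = t z * x + (1 - t z) * y"
      using d by (auto simp: t_def y_def field_simps)
    have "f z \<le> young_coeff1 p (t z) * f x + young_coeff2 p (t z) * f y"
      using young_convex_onD[OF f _ _ t01, of x y] x d
      unfolding z[symmetric] by (auto simp: y_def)
    also have "young_coeff2 p (t z) * f y \<le> young_coeff2 p (t z) * M"
      using M t01 assms(1) by (intro mult_left_mono young_coeff2_nonneg) (auto simp: y_def)
    finally show ?thesis by simp
  qed
  have lower: "(f x - young_coeff2 p (s z) * M) / young_coeff1 p (s z) \<le> f z" if "\<bar>z - x\<bar> < d" for z
  proof -
    define y where "y = (if z \<le> x then x + d else x - d)"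
    have s01: "0 < s z" "s z \<le> 1" using that d by (auto simp: s_def)
    have z: "z \<in> {a..b}" using that by (auto simp: d_def)
    have "s z * (z - y) = x - y"
      using d by (auto simp: s_def y_def field_simps)
    then have x_eq: "x = s z * z + (1 - s z) * y" by (simp add: algebra_simps)
    have "f x \<le> young_coeff1 p (s z) * f z + young_coeff2 p (s z) * f y"
      using young_convex_onD[OF f z _ s01, of y] d unfolding x_eq[symmetric]
      by (auto simp: y_def)
    also have "young_coeff2 p (s z) * f y \<le> young_coeff2 p (s z) * M"
      using M s01 assms(1) by (intro mult_left_mono young_coeff2_nonneg) (auto simp: y_def)
    finally show ?thesis
      using young_coeff1_pos[OF assms(1) s01(1)] by (simp add: field_simps)
  qed
  have coeff_lim: "((\<lambda>z. young_coeff1 p (u z)) \<longlongrightarrow> 1) (at x)"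
      "((\<lambda>z. young_coeff2 p (u z)) \<longlongrightarrow> 0) (at x)" if "isCont u x" "u x = 1" for u
    using isCont_tendsto_compose[OF isCont_young_coeff(1)[OF assms(1), of 1], of u "at x"]
      isCont_tendsto_compose[OF isCont_young_coeff(2)[OF assms(1), of 1], of u "at x"]
      that assms(1)
    by (simp_all add: isCont_def)
  have up: "((\<lambda>z. young_coeff1 p (t z) * f x + young_coeff2 p (t z) * M) \<longlongrightarrow> f x) (at x)"
    using tendsto_add[OF tendsto_mult_right[OF coeff_lim(1)[OF t]]
        tendsto_mult_right[OF coeff_lim(2)[OF t]], of "f x" M] by simp
  have lo: "((\<lambda>z. (f x - young_coeff2 p (s z) * M) / young_coeff1 p (s z)) \<longlongrightarrow> f x) (at x)"
    using tendsto_divide[OF tendsto_diff[OF tendsto_const tendsto_mult_right[OF coeff_lim(2)[OF s]]]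
        coeff_lim(1)[OF s], of "f x" M] by simp
  show ?thesis
    unfolding isCont_def
    by (rule tendsto_sandwich[OF _ _ lo up]; rule eventually_mono[OF near])
       (use upper lower in auto)
qed

text \<open>Affine substitution. Stating it with \<open>closed_segment\<close> covers both orders of
  the end points, and both are needed to average the upper bound.\<close>

lemma has_integral_segment:
  fixes f :: "real \<Rightarrow> real"
  assumes "a \<noteq> b" "(f has_integral i) (closed_segment a b)"
  shows "((\<lambda>t. f (t * a + (1 - t) * b)) has_integral i / \<bar>a - b\<bar>) {0..1}"
proof -
  define m where "m = a - b"
  have m: "m \<noteq> 0" "a = b + m" using assms(1) by (auto simp: m_def)
  have "(f has_integral i) (cbox (min a b) (max a b))"
    using assms(2) by (auto simp: closed_segment_eq_real_ivl min_def max_def split: if_splits)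
  from has_integral_affinity[OF this m(1), of b]
  have "((\<lambda>t. f (m * t + b)) has_integral i / \<bar>m\<bar>)
      ((\<lambda>x. 1 / m * x + - (1 / m * b)) ` {min a b..max a b})"
    by simp
  also have "(\<lambda>x. 1 / m * x + - (1 / m * b)) ` {min a b..max a b} = {0..1}"
  proof -
    have "1 / m * a + - (1 / m * b) = 1" using m by (simp add: add_divide_distrib)
    moreover have "1 / m * b + - (1 / m * b) = 0" by simp
    ultimately show ?thesis
      using m unfolding image_affinity_atLeastAtMost
      by (cases "m > 0") (auto simp: min_def max_def)
  qed
  also have "(\<lambda>t. f (m * t + b)) = (\<lambda>t. f (t * a + (1 - t) * b))"
    by (simp add: m_def algebra_simps)
  finally show ?thesis by (simp add: m_def)
qed

lemma young_convex_on_integrable: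
  assumes "p > 1" and f: "young_convex_on p {a..b} f" and "a < b"
  shows "f integrable_on {a..b}"
proof -
  define g where "g = (\<lambda>t. f (t * a + (1 - t) * b))"
  define h where "h = (\<lambda>t. young_coeff1 p t * f a + young_coeff2 p t * f b)"
  have mem: "a < t * a + (1 - t) * b" "t * a + (1 - t) * b < b" if "0 < t" "t < 1" for t
    using that assms(3) mult_strict_left_mono[of a b t] mult_strict_left_mono[of a b "1 - t"]
    by (auto simp: algebra_simps)
  \<comment> \<open>Continuity of \<open>f\<close> is known only at interior points, hence the open
    interval; its end points form a null set.\<close>
  have "g integrable_on {0<..<1}"
  proof (rule measurable_bounded_by_integrable_imp_integrable)
    have "isCont g t" if "t \<in> {0<..<1}" for t
    proof -
      have "isCont (\<lambda>t. t * a + (1 - t) * b) t" by (intro continuous_intros)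
      moreover have "isCont f (t * a + (1 - t) * b)"
        using that mem[of t] by (intro young_convex_on_isCont[OF assms(1) f]) auto
      ultimately show ?thesis unfolding g_def by (rule isCont_o2)
    qed
    then show "g \<in> borel_measurable (lebesgue_on {0<..<1})"
      by (intro continuous_imp_measurable_on_sets_lebesgue continuous_at_imp_continuous_on) auto
    have "h integrable_on {0..1}"
      unfolding h_def
      by (intro integrable_add integrable_on_mult_left
        has_integral_integrable[OF has_integral_young_coeff1[OF assms(1)]]
        has_integral_integrable[OF has_integral_young_coeff2[OF assms(1)]])
    then show "h integrable_on {0<..<1}"
      by (simp add: integrable_on_Icc_iff_Ioo)
    show "norm (g t) \<le> h t" if "t \<in> {0<..<1}" for t
      using young_convex_onD[OF f, of a b t] that assms(3) mem[of t]
        young_convex_on_nonneg[OF f, of "t * a + (1 - t) * b"]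
      by (auto simp: g_def h_def)
  qed auto
  then have "g integrable_on {0..1}" by (simp add: integrable_on_Icc_iff_Ioo)
  then have "(g has_integral integral {0..1} g) (cbox 0 1)" by auto
  \<comment> \<open>The substitution is undone by \<open>(x - b) / (a - b)\<close>, the inverse of
    the parametrisation, which carries \<open>{a..b}\<close> onto \<open>{0..1}\<close>.\<close>
  from has_integral_affinity[OF this, of "1 / (a - b)" "- b / (a - b)"] assms(3)
  have "(\<lambda>x. g (1 / (a - b) * x + - b / (a - b))) integrable_on {a..b}"
    by (auto simp: image_affinity_atLeastAtMost integrable_on_def)
  moreover have "g (1 / (a - b) * x + - b / (a - b)) = f x" for x
  proof -
    have eq: "1 / (a - b) * x + - b / (a - b) = (x - b) / (a - b)" by (simp add: diff_divide_distrib)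
    have "g u = f (u * (a - b) + b)" for u by (simp add: g_def algebra_simps)
    then show ?thesis using assms(3) unfolding eq by simp
  qed
  ultimately show ?thesis by simp
qed

theorem theorem4:
  fixes p a b :: real and I :: "real set" and f :: "real \<Rightarrow> real"
  assumes "p > 1"
    and "is_interval I"
    and "young_convex_on p I f"
    and "a \<in> I" "b \<in> I" "a < b"
  shows "f integrable_on {a..b}
    \<and> 2 powr (1 / p) * (p / (p + 1)) * f ((a + b) / 2) \<le> 1 / (b - a) * integral {a..b} f
    \<and> 1 / (b - a) * integral {a..b} f
        \<le> (p * (p + 2) / ((p + 1) * (1 + 2 * p))
            + (p - 1) / p * Beta ((1 + p) / p) 2
            + 1 / p * Beta (1 / p) 2) * ((f a + f b) / 2)"
proof -
  have "{a..b} \<subseteq> I" using assms interval_subset_is_interval[of I a b] by auto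
  then have f: "young_convex_on p {a..b} f"
    using assms(3) unfolding young_convex_on_def by blast
  have ab: "a \<in> {a..b}" "b \<in> {a..b}" using assms by auto
  have int: "f integrable_on {a..b}"
    using young_convex_on_integrable[OF assms(1) f assms(6)] .
  define J where "J = integral {a..b} f / (b - a)"
  define C1 where "C1 = p * (p + 2) / ((p + 1) * (1 + 2 * p))"
  define C2 where "C2 = (p - 1) / p * Beta ((1 + p) / p) 2 + 1 / p * Beta (1 / p) 2"
  define g where "g = (\<lambda>x y t. f (t * x + (1 - t) * y))"
  \<comment> \<open>Traversing the segment in either direction gives the same mean value
    \<open>J\<close>. Dropping the end points avoids \<open>t = 0\<close>, where Young-convexity
    says nothing.\<close>
  have g: "(g a b has_integral J) {0<..<1}" "(g b a has_integral J) {0<..<1}"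
    using has_integral_segment[of a b f "integral {a..b} f"]
      has_integral_segment[of b a f "integral {a..b} f"] int assms(6)
    unfolding has_integral_Icc_iff_Ioo[symmetric] g_def J_def
    by (simp_all add: closed_segment_eq_real_ivl integrable_integral)
  have upper: "J \<le> C1 * f x + C2 * f y"
    if "(g x y has_integral J) {0<..<1}" "x \<in> {a..b}" "y \<in> {a..b}" for x y
  proof (rule has_integral_le[OF that(1)])
    show "((\<lambda>t. young_coeff1 p t * f x + young_coeff2 p t * f y) has_integral
        C1 * f x + C2 * f y) {0<..<1}"
      unfolding has_integral_Icc_iff_Ioo[symmetric] C1_def C2_def using assms(1)
      by (intro has_integral_add has_integral_mult_left has_integral_young_coeff1
        has_integral_young_coeff2)
  qed (use young_convex_onD[OF f that(2,3)] in \<open>auto simp: g_def\<close>)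
  \<comment> \<open>The common value of both coefficients at \<open>1/2\<close>.\<close>
  define K where "K = (p + 1) / (2 * p) / 2 powr (1 / p)"
  have "f ((a + b) / 2) \<le> K * (J + J)"
  proof (rule has_integral_le)
    show "((\<lambda>t::real. f ((a + b) / 2)) has_integral f ((a + b) / 2)) {0<..<1}"
      using has_integral_const_real[of "f ((a + b) / 2)" 0 1]
      by (simp add: has_integral_Icc_iff_Ioo)
    show "((\<lambda>t. K * (g a b t + g b a t)) has_integral K * (J + J)) {0<..<1}"
      by (intro has_integral_mult_right has_integral_add g)
    \<comment> \<open>The points at which \<open>g a b t\<close> and \<open>g b a t\<close> evaluate
      \<open>f\<close> are symmetric about the midpoint, so it is their combination with equal
      weights.\<close>
    show "f ((a + b) / 2) \<le> K * (g a b t + g b a t)" if "t \<in> {0<..<1}" for t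
    proof -
      have seg: "t * a + (1 - t) * b \<in> {a..b}" "t * b + (1 - t) * a \<in> {a..b}"
        using that ab convexD_alt[of "{a..b}" b a t] convexD_alt[of "{a..b}" a b t]
        by (auto simp: algebra_simps)
      have mid: "1 / 2 * (t * a + (1 - t) * b) + (1 - 1 / 2) * (t * b + (1 - t) * a) = (a + b) / 2"
        by (simp add: field_simps)
      have "f ((a + b) / 2) \<le> K * g a b t + K * g b a t"
        using young_convex_onD[OF f seg, of "1 / 2"]
        unfolding g_def K_def young_coeff_half[OF assms(1)] mid by simp
      then show ?thesis by (simp add: distrib_left)
    qed
  qed
  then have "2 powr (1 / p) * (p / (p + 1)) * f ((a + b) / 2) \<le> J"
    using assms(1) by (simp add: K_def field_simps)
  \<comment> \<open>Adding the bounds for the two orders of \<open>a\<close> and \<open>b\<close>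
    gives both values of \<open>f\<close> the same factor \<open>C1 + C2\<close>.\<close>
  moreover have "J \<le> (C1 + C2) * ((f a + f b) / 2)"
    using upper[OF g(1) ab] upper[OF g(2) ab(2,1)] by (simp add: field_simps)
  ultimately show ?thesis
    using int by (simp add: J_def C1_def C2_def add.assoc)
qed

end
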